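(* Let $X$ be a nonempty set, $Y$ a nonempty subset of $X$, and $f\in\overline{S}(X,Y)$. Then $f\in\operatorname{ureg}(\overline{S}(X,Y))$ if and only if $|X\setminus T_f|=|X\setminus Xf|$ for some transversal $T_f$ of $\ker(f)$ such that $Y\subseteq T_f$.
   Context: $T(X)$ is the semigroup of all maps $X\to X$ under composition; maps are written on the right and composed from left to right, so $x(fg)=(xf)g$, and for $B\subseteq X$, $Bf=\{xf\colon x\in B\}$. If $Yf\subseteq Y$, then $f_{\upharpoonright Y}\colon Y\to Y$ denotes the map that agrees with $f$ on $Y$. Let $S(Y)$ be the symmetric group on $Y$ (all bijections $Y\to Y$), and let $\overline{S}(X,Y)=\{f\in T(X)\colon Yf\subseteq Y \text{ and } f_{\upharpoonright Y}\in S(Y)\}$, a subsemigroup of $T(X)$ containing the identity map. For a semigroup $S$ with identity, $U(S)$ is the set of all units of $S$; an element $a\in S$ is unit-regular if $aba=a$ for some $b\in U(S)$, and $\operatorname{ureg}(S)$ is the set of all unit-regular elements of $S$. $\ker(f)$ is the equivalence relation on $X$ with $(a,b)\in\ker(f)$ iff $af=bf$. A transversal of an equivalence relation on $X$ is a subset of $X$ containing exactly one element of each equivalence class. $|A|$ denotes the cardinality of $A$. *)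

theory Defs
  imports "HOL-Algebra.Bij" "HOL-Library.Equipollence"
begin

text \<open>Self-maps of a set \<open>X\<close> are represented by functions that are \<open>undefined\<close> outside \<open>X\<close>, so
  that equality of such functions is equality of maps on \<open>X\<close>. Maps are written on the right and
  composed from left to right, i.e. \<open>x (f g) = (x f) g\<close>, whereas \<^const>\<open>compose\<close> composes from
  right to left; hence the swapped arguments.\<close>

definition T :: "'a set \<Rightarrow> ('a \<Rightarrow> 'a) monoid" where
  "T X = \<lparr>carrier = X \<rightarrow>\<^sub>E X, mult = (\<lambda>f g. compose X g f), one = (\<lambda>x\<in>X. x)\<rparr>"

text \<open>\<^term>\<open>Bij Y\<close> is the set of all (extensional) bijections from \<open>Y\<close> to \<open>Y\<close>.\<close>

definition S_bar :: "'a set \<Rightarrow> 'a set \<Rightarrow> ('a \<Rightarrow> 'a) monoid" where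
  "S_bar X Y = (T X)\<lparr>carrier := {f \<in> carrier (T X). f ` Y \<subseteq> Y \<and> restrict f Y \<in> Bij Y}\<rparr>"

definition ureg :: "('a, 'b) monoid_scheme \<Rightarrow> 'a set" where
  "ureg S = {a \<in> carrier S. \<exists>b\<in>Units S. a \<otimes>\<^bsub>S\<^esub> b \<otimes>\<^bsub>S\<^esub> a = a}"

definition ker :: "'a set \<Rightarrow> ('a \<Rightarrow> 'b) \<Rightarrow> ('a \<times> 'a) set" where
  "ker X f = {(a, b). a \<in> X \<and> b \<in> X \<and> f a = f b}"

definition transversal :: "'a set \<Rightarrow> ('a \<times> 'a) set \<Rightarrow> 'a set \<Rightarrow> bool" where
  "transversal X r A \<longleftrightarrow> A \<subseteq> X \<and> (\<forall>C \<in> X // r. \<exists>!x. x \<in> A \<and> x \<in> C)"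

lemma monoid_T: "monoid (T X)"
  by unfold_locales
    (auto simp: T_def compose_assoc compose_def PiE_iff extensional_def fun_eq_iff)

lemma submonoid_S_bar:
  assumes "Y \<subseteq> X"
  shows "submonoid (carrier (S_bar X Y)) (T X)"
proof
  show "carrier (S_bar X Y) \<subseteq> carrier (T X)"
    by (auto simp: S_bar_def)
  show "\<one>\<^bsub>T X\<^esub> \<in> carrier (S_bar X Y)"
    using assms by (auto simp: S_bar_def T_def Bij_def bij_betw_def inj_on_def subset_iff)
  show "f \<otimes>\<^bsub>T X\<^esub> g \<in> carrier (S_bar X Y)"
    if "f \<in> carrier (S_bar X Y)" "g \<in> carrier (S_bar X Y)" for f g
  proof -
    have f: "f \<in> X \<rightarrow>\<^sub>E X" "bij_betw f Y Y" and g: "g \<in> X \<rightarrow>\<^sub>E X" "bij_betw g Y Y"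
      using that by (auto simp: S_bar_def T_def Bij_def)
    have "bij_betw (g \<circ> f) Y Y"
      using f g by (blast intro: bij_betw_trans)
    then have b: "bij_betw (compose X g f) Y Y"
      using assms by (subst bij_betw_cong[where g = "g \<circ> f"]) (auto simp: compose_def)
    moreover have "compose X g f \<in> X \<rightarrow>\<^sub>E X"
      using f g by (auto simp: compose_def)
    ultimately show ?thesis
      by (auto simp: S_bar_def T_def Bij_def bij_betw_def)
  qed
qed

lemma monoid_S_bar: "Y \<subseteq> X \<Longrightarrow> monoid (S_bar X Y)"
  using submonoid.submonoid_is_monoid[OF submonoid_S_bar monoid_T] by (simp add: S_bar_def)

lemma equiv_ker: "equiv X (ker X f)"
  by (auto simp: ker_def equiv_def refl_on_def sym_def trans_def)

end

theory Submission
  imports Defs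
begin

text \<open>
  A transversal of the kernel of \<open>f\<close> is the same thing as a set \<open>A \<subseteq> X\<close> that \<open>f\<close> maps bijectively
  onto \<open>f ` X\<close>, and a unit of the monoid is an element that permutes \<open>X\<close>. An equation
  \<open>f b f = f\<close> says that \<open>b\<close> sends every point of the image of \<open>f\<close> to one of its preimages.

  If a unit \<open>b\<close> satisfies this, then it singles out one preimage of each point of the image, so
  \<open>b ` f ` X\<close> is a transversal; it contains \<open>Y\<close> because \<open>f\<close> and \<open>b\<close> both permute \<open>Y\<close>. Being a
  permutation of \<open>X\<close>, \<open>b\<close> carries the complement of the image onto the complement of this
  transversal, which yields the equality of cardinalities.

  Conversely, let \<open>A \<supseteq> Y\<close> be a transversal whose complement has the same size as that of the image.
  The inverse of \<open>f\<close> restricted to \<open>A\<close> maps the image bijectively onto \<open>A\<close>, and any bijection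
  between the two complements extends it to a permutation \<open>b\<close> of \<open>X\<close> with \<open>f b f = f\<close>. The inclusion
  \<open>Y \<subseteq> A\<close> makes \<open>b\<close> agree on \<open>Y\<close> with the inverse of the permutation of \<open>Y\<close> induced by \<open>f\<close>, so
  \<open>b\<close> belongs to the monoid and is a unit there.
\<close>

lemma carrier_S_bar_iff:
  "f \<in> carrier (S_bar X Y) \<longleftrightarrow> f \<in> X \<rightarrow>\<^sub>E X \<and> bij_betw f Y Y"
  by (auto simp: S_bar_def T_def Bij_def bij_betw_def)

lemma mult_S_bar: "f \<otimes>\<^bsub>S_bar X Y\<^esub> g = compose X g f"
  by (simp add: S_bar_def T_def)

lemma one_S_bar: "\<one>\<^bsub>S_bar X Y\<^esub> = (\<lambda>x\<in>X. x)"
  by (simp add: S_bar_def T_def)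

text \<open>Invertibility in the submonoid asks no more than invertibility of the map: the inverse of a
  permutation of \<open>X\<close> that maps \<open>Y\<close> onto itself again maps \<open>Y\<close> onto itself.\<close>

lemma Units_S_bar_iff:
  assumes "Y \<subseteq> X"
  shows "b \<in> Units (S_bar X Y) \<longleftrightarrow> b \<in> carrier (S_bar X Y) \<and> bij_betw b X X"
proof
  assume "b \<in> Units (S_bar X Y)"
  then obtain c where b: "b \<in> carrier (S_bar X Y)" and c: "c \<in> carrier (S_bar X Y)"
    and cb: "compose X b c = (\<lambda>x\<in>X. x)" and bc: "compose X c b = (\<lambda>x\<in>X. x)"
    by (auto simp: Units_def mult_S_bar one_S_bar)
  have "bij_betw b X X"
  proof (rule bij_betw_byWitness[where f' = c])
    show "\<forall>x\<in>X. c (b x) = x"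
      using bc by (metis compose_eq restrict_apply')
    show "\<forall>x\<in>X. b (c x) = x"
      using cb by (metis compose_eq restrict_apply')
  qed (use b c in \<open>auto simp: carrier_S_bar_iff\<close>)
  with b show "b \<in> carrier (S_bar X Y) \<and> bij_betw b X X" ..
next
  assume "b \<in> carrier (S_bar X Y) \<and> bij_betw b X X"
  then have b: "b \<in> carrier (S_bar X Y)" and bX: "bij_betw b X X"
    by auto
  define c where "c = restrict (inv_into X b) X"
  have "bij_betw (inv_into X b) Y Y"
    using bX assms b
    by (rule_tac bij_betw_inv_into_subset) (auto simp: carrier_S_bar_iff bij_betw_def)
  then have "bij_betw c Y Y"
    using assms by (subst bij_betw_cong[where g = "inv_into X b"]) (auto simp: c_def)
  moreover have "c \<in> X \<rightarrow>\<^sub>E X"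
    using bX by (auto simp: c_def bij_betw_def inv_into_into)
  ultimately have "c \<in> carrier (S_bar X Y)"
    by (simp add: carrier_S_bar_iff)
  moreover have "compose X b c = (\<lambda>x\<in>X. x)"
    using bX by (auto simp: c_def compose_def fun_eq_iff bij_betw_inv_into_right)
  moreover have "compose X c b = (\<lambda>x\<in>X. x)"
    using bX by (auto simp: c_def compose_def fun_eq_iff bij_betw_inv_into_left bij_betw_apply)
  ultimately show "b \<in> Units (S_bar X Y)"
    using b by (auto simp: Units_def mult_S_bar one_S_bar)
qed

text \<open>The kernel classes are the nonempty fibres of \<open>f\<close>: that \<open>A\<close> meets each of them means
  \<open>f ` A = f ` X\<close>, and that it meets none of them twice means that \<open>f\<close> is injective on \<open>A\<close>.\<close>

lemma transversal_ker_iff: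
  "transversal X (ker X f) A \<longleftrightarrow> A \<subseteq> X \<and> bij_betw f A (f ` X)"
proof -
  have "ker X f `` {x} = {u \<in> X. f u = f x}" if "x \<in> X" for x
    using that by (auto simp: ker_def)
  then have "X // ker X f = (\<lambda>x. {u \<in> X. f u = f x}) ` X"
    by (auto simp: quotient_def)
  then have tr: "transversal X (ker X f) A \<longleftrightarrow>
      A \<subseteq> X \<and> (\<forall>x\<in>X. \<exists>!u. u \<in> A \<and> u \<in> X \<and> f u = f x)"
    by (simp add: transversal_def)
  show ?thesis
  proof
    assume "transversal X (ker X f) A"
    then have A: "A \<subseteq> X" and ex1: "\<And>x. x \<in> X \<Longrightarrow> \<exists>!u. u \<in> A \<and> u \<in> X \<and> f u = f x"
      by (auto simp: tr)
    have "inj_on f A"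
      using A ex1 by (intro inj_onI) (metis subsetD)
    moreover have "f ` X \<subseteq> f ` A"
      using ex1 by (metis image_eqI image_subsetI)
    ultimately show "A \<subseteq> X \<and> bij_betw f A (f ` X)"
      using A by (auto simp: bij_betw_def)
  next
    assume A: "A \<subseteq> X \<and> bij_betw f A (f ` X)"
    have "\<exists>!u. u \<in> A \<and> u \<in> X \<and> f u = f x" if "x \<in> X" for x
    proof -
      have "f x \<in> f ` A"
        using A that by (simp add: bij_betw_def)
      then obtain u where "u \<in> A" "f u = f x"
        by auto
      with A show ?thesis
        by (metis bij_betw_def inj_onD subsetD)
    qed
    with A show "transversal X (ker X f) A"
      by (simp add: tr)
  qed
qed

lemma regular_eq_iff:
  assumes "f \<in> X \<rightarrow>\<^sub>E X"
  shows "f \<otimes>\<^bsub>S_bar X Y\<^esub> b \<otimes>\<^bsub>S_bar X Y\<^esub> f = f \<longleftrightarrow> (\<forall>x\<in>X. f (b (f x)) = f x)"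
  using assms by (auto simp: mult_S_bar compose_def fun_eq_iff PiE_iff extensional_def)

theorem theorem3p4:
  fixes X Y :: "'a set" and f :: "'a \<Rightarrow> 'a"
  assumes "X \<noteq> {}" and "Y \<noteq> {}" and "Y \<subseteq> X"
    and "f \<in> carrier (S_bar X Y)"
  shows "f \<in> ureg (S_bar X Y) \<longleftrightarrow>
    (\<exists>T\<^sub>f. transversal X (ker X f) T\<^sub>f \<and> Y \<subseteq> T\<^sub>f \<and> X - T\<^sub>f \<approx> X - f ` X)"
proof -
  have f: "f \<in> X \<rightarrow>\<^sub>E X" and fY: "f ` Y = Y"
    using assms(4) by (auto simp: carrier_S_bar_iff bij_betw_def)
  then have fX: "f ` X \<subseteq> X"
    by auto
  show ?thesis
  proof
    assume "f \<in> ureg (S_bar X Y)"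
    then obtain b where b: "b \<in> carrier (S_bar X Y)" and bX: "bij_betw b X X"
      and fbf: "\<And>x. x \<in> X \<Longrightarrow> f (b (f x)) = f x"
      using f by (auto simp: ureg_def regular_eq_iff Units_S_bar_iff[OF assms(3)])
    have "transversal X (ker X f) (b ` f ` X)"
      unfolding transversal_ker_iff
    proof
      show "b ` f ` X \<subseteq> X"
        using bX fX by (auto simp: bij_betw_def)
      show "bij_betw f (b ` f ` X) (f ` X)"
        by (rule bij_betw_byWitness[where f' = b]) (auto simp: fbf)
    qed
    moreover have "Y \<subseteq> b ` f ` X"
    proof -
      have "Y = b ` f ` Y"
        using b fY by (auto simp: carrier_S_bar_iff bij_betw_def)
      then show ?thesis
        using assms(3) by blast
    qed
    moreover have "X - b ` f ` X \<approx> X - f ` X"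
    proof -
      have inj: "inj_on b X" and "b ` X = X"
        using bX by (auto simp: bij_betw_def)
      then have "b ` (X - f ` X) = X - b ` f ` X"
        using fX by (simp add: inj_on_image_set_diff[where C = X])
      moreover have "inj_on b (X - f ` X)"
        using inj by (rule inj_on_subset) auto
      ultimately show ?thesis
        by (metis inj_on_image_eqpoll_self)
    qed
    ultimately show "\<exists>T\<^sub>f. transversal X (ker X f) T\<^sub>f \<and> Y \<subseteq> T\<^sub>f \<and> X - T\<^sub>f \<approx> X - f ` X"
      by blast
  next
    assume "\<exists>T\<^sub>f. transversal X (ker X f) T\<^sub>f \<and> Y \<subseteq> T\<^sub>f \<and> X - T\<^sub>f \<approx> X - f ` X"
    then obtain A h where A: "A \<subseteq> X" "bij_betw f A (f ` X)" and YA: "Y \<subseteq> A"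
      and h: "bij_betw h (X - f ` X) (X - A)"
      by (metis transversal_ker_iff eqpoll_sym eqpoll_def)
    define g where "g = inv_into A f"
    have g: "bij_betw g (f ` X) A"
      unfolding g_def using A(2) by (rule bij_betw_inv_into)
    define b where "b = restrict (\<lambda>x. if x \<in> f ` X then g x else h x) X"
    have b_image: "b x = g x" if "x \<in> f ` X" for x
      using that fX by (auto simp: b_def)
    have "bij_betw b (f ` X) A"
      using g b_image by (simp cong: bij_betw_cong)
    moreover have "bij_betw b (X - f ` X) (X - A)"
      using h by (subst bij_betw_cong[where g = h]) (auto simp: b_def)
    ultimately have "bij_betw b (f ` X \<union> (X - f ` X)) (A \<union> (X - A))"
      by (rule bij_betw_combine) auto
    then have bX: "bij_betw b X X"
      using fX A(1) by (simp add: Un_absorb1)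
    have "bij_betw g Y Y"
      unfolding g_def by (rule bij_betw_inv_into_subset[OF A(2) YA fY])
    moreover have "Y \<subseteq> f ` X"
      using fY assms(3) by blast
    ultimately have bY: "bij_betw b Y Y"
      using b_image by (subst bij_betw_cong[where g = g]) auto
    have "b \<in> X \<rightarrow>\<^sub>E X"
      using bX by (auto simp: bij_betw_apply) (simp add: b_def)
    with bX bY have "b \<in> Units (S_bar X Y)"
      by (simp add: Units_S_bar_iff[OF assms(3)] carrier_S_bar_iff)
    moreover have "f (b (f x)) = f x" if "x \<in> X" for x
      using that b_image bij_betw_inv_into_right[OF A(2)] by (simp add: g_def)
    ultimately show "f \<in> ureg (S_bar X Y)"
      using assms(4) f by (auto simp: ureg_def regular_eq_iff)
  qed
qed

end
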